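(* Let $\alpha$ and $n$ be non-negative integers. (i) Let $p$ be a prime with $p \equiv 1 \pmod 6$. If $p \nmid (3n+1)$ and $B_{3,7} \left(\frac{p-1}{3}\right)\equiv 0 \pmod 3$, then $B_{3,7}\left(p^{2 \alpha+1}n+ \frac{p^{2 \alpha +1}-1}{3}\right) \equiv 0 \pmod 3$. (ii) Let $p$ be a prime with $p \equiv 1 \pmod 4$. If $p \nmid (4n+1)$ and $B_{3,5} \left(\frac{p-1}{4}\right)\equiv 0 \pmod 3$, then $B_{3,5}\left(p^{2 \alpha+1}n+ \frac{p^{2 \alpha +1}-1}{4}\right) \equiv 0 \pmod 3$. (iii) Let $p$ be a prime with $p \equiv 1 \pmod 8$. If $p \nmid (8n+1)$ and $B_{3,2} \left(\frac{p-1}{8}\right)\equiv 0 \pmod 3$, then $B_{3,2}\left(p^{2 \alpha+1}n+ \frac{p^{2 \alpha +1}-1}{8}\right) \equiv 0 \pmod 3$.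
   Context: For integers $u,v\ge 2$, $B_{u,v}(n)$ is the number of bipartitions $(\alpha,\beta)$ of $n$ with $\alpha$ having no part divisible by $u$ and $\beta$ having no part divisible by $v$; $B_{u,v}(0)=1$ and $\sum_{n\ge0}B_{u,v}(n)q^n=\frac{f_uf_v}{f_1^2}$, $f_t=\prod_{k\ge1}(1-q^{tk})$. *)

theory Defs
  imports "HOL-Library.Multiset" "HOL-Number_Theory.Number_Theory"
begin

text \<open>A partition of \<open>n\<close> is represented by the multiset of its parts, all of which are positive.\<close>

definition is_partition :: "nat multiset \<Rightarrow> nat \<Rightarrow> bool" where
  "is_partition P n \<longleftrightarrow> 0 \<notin># P \<and> sum_mset P = n"

definition regular :: "nat \<Rightarrow> nat multiset \<Rightarrow> bool" where
  "regular u P \<longleftrightarrow> (\<forall>k\<in>#P. \<not> u dvd k)"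

definition bipartitions :: "nat \<Rightarrow> (nat multiset \<times> nat multiset) set" where
  "bipartitions n = {(P, Q). \<exists>i j. i + j = n \<and> is_partition P i \<and> is_partition Q j}"

definition B :: "nat \<Rightarrow> nat \<Rightarrow> nat \<Rightarrow> nat" where
  "B u v n = card {(P, Q) \<in> bipartitions n. regular u P \<and> regular v Q}"

lemma finite_partitions: "finite {P. is_partition P n}"
proof (rule finite_subset)
  show "{P. is_partition P n} \<subseteq> mset ` {xs. set xs \<subseteq> {..n} \<and> length xs \<le> n}"
  proof
    fix P assume "P \<in> {P. is_partition P n}"
    then have P: "0 \<notin># P" "sum_mset P = n" by (auto simp: is_partition_def)
    obtain xs where xs: "mset xs = P" using ex_mset by blast
    have "size M \<le> sum_mset M" if "0 \<notin># M" for M :: "nat multiset"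
      using that by (induction M) auto
    then have "length xs \<le> n" using P xs by (metis size_mset)
    moreover have "set xs \<subseteq> {..n}"
      using P xs by (auto simp: sum_mset_sum_list intro: member_le_sum_list)
    ultimately show "P \<in> mset ` {xs. set xs \<subseteq> {..n} \<and> length xs \<le> n}" using xs by blast
  qed
  show "finite (mset ` {xs. set xs \<subseteq> {..n} \<and> length xs \<le> n})"
    by (intro finite_imageI finite_lists_length_le) simp
qed

lemma finite_bipartitions: "finite (bipartitions n)"
proof (rule finite_subset)
  show "bipartitions n \<subseteq> (\<Union>i\<le>n. {P. is_partition P i}) \<times> (\<Union>i\<le>n. {P. is_partition P i})"
    unfolding bipartitions_def by (fastforce intro: le_add1 le_add2)
qed (simp add: finite_partitions)

end

theory Submission
  imports Defs "HOL-Computational_Algebra.Formal_Power_Series" "HOL-Library.Discrete_Functions"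
begin

text \<open>
  Modulo 3 we have \<open>f\<^sub>3 \<equiv> f\<^sub>1\<^sup>3\<close>, so the generating function of \<open>B\<^sub>3\<^sub>,\<^sub>D\<close> is congruent to
  \<open>f\<^sub>1 f\<^sub>D\<close>. Euler's pentagonal number theorem turns the coefficient of \<open>q\<^sup>m\<close> into the sum of
  \<open>(-1)\<^sup>i\<^sup>+\<^sup>j\<close> over all \<open>(i, j)\<close> with \<open>(6i+1)\<^sup>2 + D(6j+1)\<^sup>2 = 24m + D + 1\<close>, and \<open>24m + D + 1\<close> is
  \<open>(D+1)(tm+1)\<close> with \<open>t = 24/(D+1) = 3, 4, 8\<close> for \<open>D = 7, 5, 2\<close>. If \<open>-D\<close> is not a square modulo
  \<open>p\<close>, then the form \<open>x\<^sup>2 + Dy\<^sup>2\<close> represents no number with odd \<open>p\<close>-adic valuation, so the sum for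
  \<open>tm + 1 = p\<^sup>2\<^sup>\<alpha>\<^sup>+\<^sup>1(tn+1)\<close> is empty. Otherwise the hypothesis on \<open>p\<close> fails: either \<open>p = D\<close> and there
  is exactly one solution for \<open>tm + 1 = p\<close>, or \<open>p = c\<^sup>2 + Dd\<^sup>2\<close> and
  \<open>(D+1)p = (c \<mp> Dd)\<^sup>2 + D(c \<plusminus> d)\<^sup>2\<close> are the only two solutions; they carry the same sign, so the
  sum is \<open>\<plusminus>2\<close>.
\<close>

section \<open>The generating function modulo 3\<close>

definition partition_fps :: "nat set \<Rightarrow> int fps" where
  "partition_fps S = Abs_fps (\<lambda>n. int (card {P. is_partition P n \<and> set_mset P \<subseteq> S}))"

definition fps_cong :: "int \<Rightarrow> nat \<Rightarrow> int fps \<Rightarrow> int fps \<Rightarrow> bool" where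
  "fps_cong m N f g \<longleftrightarrow> (\<forall>i\<le>N. [fps_nth f i = fps_nth g i] (mod m))"

lemma fps_cong_refl [simp]: "fps_cong m N f f"
  by (simp add: fps_cong_def)

lemma fps_cong_sym: "fps_cong m N f g \<Longrightarrow> fps_cong m N g f"
  by (simp add: fps_cong_def cong_sym_eq)

lemma fps_cong_trans [trans]: "fps_cong m N f g \<Longrightarrow> fps_cong m N g h \<Longrightarrow> fps_cong m N f h"
  by (auto simp: fps_cong_def intro: cong_trans)

lemma fps_cong_mult:
  assumes "fps_cong m N f g" "fps_cong m N f' g'"
  shows "fps_cong m N (f * f') (g * g')"
  using assms unfolding fps_cong_def fps_mult_nth by (auto intro!: cong_sum cong_mult)

lemma fps_cong_prod_1:
  assumes "\<And>k. k \<in> S \<Longrightarrow> fps_cong m N (f k) 1"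
  shows "fps_cong m N (prod f S) 1"
  using assms
proof (induction S rule: infinite_finite_induct)
  case (insert x S)
  then have "fps_cong m N (f x * prod f S) (1 * 1)"
    by (intro fps_cong_mult insert.IH insert.prems) auto
  with insert.hyps show ?case by simp
qed auto

lemma partition_fps_insert:
  assumes "k > 0" "k \<notin> S"
  shows "partition_fps (insert k S) * (1 - fps_X ^ k) = partition_fps S"
proof (rule fps_ext)
  fix n
  define p where "p T n = {P. is_partition P n \<and> set_mset P \<subseteq> T}" for T n
  have fin: "finite (p T n)" for T n
    by (rule finite_subset[OF _ finite_partitions[of n]]) (auto simp: p_def)
  have nth: "fps_nth (partition_fps T) n = int (card (p T n))" for T n
    by (simp add: partition_fps_def p_def)
  have split: "p (insert k S) n = p S n \<union> (if n < k then {} else add_mset k ` p (insert k S) (n - k))"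
  proof (intro equalityI subsetI)
    fix P assume P: "P \<in> p (insert k S) n"
    show "P \<in> p S n \<union> (if n < k then {} else add_mset k ` p (insert k S) (n - k))"
    proof (cases "k \<in># P")
      case True
      then obtain Q where "P = add_mset k Q" by (meson multi_member_split)
      with P show ?thesis by (auto simp: p_def is_partition_def)
    qed (use P in \<open>auto simp: p_def\<close>)
  next
    fix P assume "P \<in> p S n \<union> (if n < k then {} else add_mset k ` p (insert k S) (n - k))"
    then show "P \<in> p (insert k S) n"
      using \<open>k > 0\<close> by (auto simp: p_def is_partition_def split: if_splits)
  qed
  have "card (p (insert k S) n) = card (p S n) + (if n < k then 0 else card (p (insert k S) (n - k)))"
    unfolding split
    by (subst card_Un_disjoint)
      (use fin \<open>k \<notin> S\<close> in \<open>auto simp: card_image inj_on_def p_def\<close>)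
  then show "fps_nth (partition_fps (insert k S) * (1 - fps_X ^ k)) n = fps_nth (partition_fps S) n"
    by (simp add: right_diff_distrib fps_X_power_mult_right_nth nth)
qed

lemma partition_fps_empty: "partition_fps {} = 1"
proof (rule fps_ext)
  fix n
  have "{P. is_partition P n \<and> set_mset P \<subseteq> {}} = (if n = 0 then {{#}} else {})"
    by (auto simp: is_partition_def)
  then show "fps_nth (partition_fps {}) n = fps_nth 1 n"
    by (simp add: partition_fps_def)
qed

lemma partition_fps_mult_prod:
  assumes "finite S" "0 \<notin> S"
  shows "partition_fps S * (\<Prod>k\<in>S. 1 - fps_X ^ k) = 1"
  using assms
proof (induction S rule: finite_induct)
  case (insert k S)
  then have "partition_fps (insert k S) * (1 - fps_X ^ k) = partition_fps S"
    by (intro partition_fps_insert) auto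
  with insert show ?case by (simp add: mult.assoc[symmetric])
qed (simp add: partition_fps_empty)

lemma B_eq_fps_nth:
  "int (B u v n) = fps_nth (partition_fps {k\<in>{1..n}. \<not> u dvd k} * partition_fps {k\<in>{1..n}. \<not> v dvd k}) n"
proof -
  define r where "r u i = {P. is_partition P i \<and> regular u P}" for u i
  have fin: "finite (r u i)" for u i
    by (rule finite_subset[OF _ finite_partitions[of i]]) (auto simp: r_def)
  have r: "{P. is_partition P i \<and> set_mset P \<subseteq> {k\<in>{1..n}. \<not> u dvd k}} = r u i" if "i \<le> n" for u i
  proof -
    have "k \<in> {1..n}" if "is_partition P i" "k \<in># P" for P k
    proof -
      have "k \<le> sum_mset P" using that(2) by (auto dest!: multi_member_split)
      moreover have "k \<noteq> 0" using that by (metis is_partition_def)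
      ultimately show ?thesis using that \<open>i \<le> n\<close> by (auto simp: is_partition_def)
    qed
    then show ?thesis by (fastforce simp: r_def regular_def)
  qed
  have "{(P, Q) \<in> bipartitions n. regular u P \<and> regular v Q} = (\<Union>i\<in>{..n}. r u i \<times> r v (n - i))"
    by (fastforce simp: bipartitions_def r_def is_partition_def)
  then have "B u v n = card (\<Union>i\<in>{..n}. r u i \<times> r v (n - i))"
    by (simp add: B_def)
  also have "\<dots> = (\<Sum>i\<le>n. card (r u i \<times> r v (n - i)))"
    by (rule card_UN_disjoint) (auto simp: fin, auto simp: r_def is_partition_def)
  finally have "int (B u v n) = (\<Sum>i\<le>n. int (card (r u i)) * int (card (r v (n - i))))"
    by (simp add: card_cartesian_product)
  moreover have "fps_nth (partition_fps {k\<in>{1..n}. \<not> u dvd k}) i = int (card (r u i))" if "i \<le> n" for u i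
    unfolding partition_fps_def fps_nth_Abs_fps r[OF that] ..
  ultimately show ?thesis
    by (simp add: fps_mult_nth atLeast0AtMost del: atLeastAtMost_iff)
qed

lemma prod_one_minus_power_cube:
  "\<exists>b. (\<Prod>k\<in>S. 1 - x ^ (3 * k)) = (\<Prod>k\<in>S. 1 - x ^ k) ^ 3 + 3 * (b :: 'a :: comm_ring_1)"
proof (induction S rule: infinite_finite_induct)
  case (insert k S)
  then obtain b where b: "(\<Prod>k\<in>S. 1 - x ^ (3 * k)) = (\<Prod>k\<in>S. 1 - x ^ k) ^ 3 + 3 * b" by blast
  have "x ^ (3 * k) = (x ^ k) ^ 3"
    by (simp add: power_mult[symmetric] mult.commute)
  then have "1 - x ^ (3 * k) = (1 - x ^ k) ^ 3 + 3 * (x ^ k - (x ^ k)\<^sup>2)"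
    by (simp add: power3_eq_cube power2_eq_square algebra_simps)
  then have "(\<Prod>k\<in>insert k S. 1 - x ^ (3 * k)) =
     ((1 - x ^ k) ^ 3 + 3 * (x ^ k - (x ^ k)\<^sup>2)) * ((\<Prod>k\<in>S. 1 - x ^ k) ^ 3 + 3 * b)"
    using insert.hyps b by simp
  also have "\<dots> = ((1 - x ^ k) * (\<Prod>k\<in>S. 1 - x ^ k)) ^ 3 +
     3 * ((1 - x ^ k) ^ 3 * b + (x ^ k - (x ^ k)\<^sup>2) * ((\<Prod>k\<in>S. 1 - x ^ k) ^ 3 + 3 * b))"
    unfolding power_mult_distrib by (simp only: distrib_left distrib_right ac_simps)
  also have "(1 - x ^ k) * (\<Prod>k\<in>S. 1 - x ^ k) = (\<Prod>k\<in>insert k S. 1 - x ^ k)"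
    using insert.hyps by simp
  finally show ?case by blast
qed (auto intro: exI[of _ 0])

lemma B_3_cong_euler_prod:
  assumes "v > 0"
  shows "[int (B 3 v n) = fps_nth ((\<Prod>k=1..n. 1 - fps_X ^ k) * (\<Prod>k=1..n. 1 - (fps_X ^ v) ^ k)) n] (mod 3)"
proof -
  define P :: "int fps" where "P = (\<Prod>k=1..n. 1 - fps_X ^ k)"
  define R where "R = partition_fps {1..n}"
  define S where "S u = partition_fps {k\<in>{1..n}. \<not> u dvd k}" for u
  define E :: "nat \<Rightarrow> int fps" where "E u = (\<Prod>k=1..n. 1 - fps_X ^ (u * k))" for u
  have RP: "R * P = 1"
    unfolding R_def P_def by (rule partition_fps_mult_prod) auto
  have SE: "fps_cong 3 n (S u) (R * E u)" if "u > 0" for u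
  proof -
    define Q :: "int fps" where "Q = (\<Prod>k\<in>{k\<in>{1..n}. u dvd k}. 1 - fps_X ^ k)"
    have "P = (\<Prod>k\<in>{k\<in>{1..n}. \<not> u dvd k} \<union> {k\<in>{1..n}. u dvd k}. 1 - fps_X ^ k)"
      unfolding P_def by (rule prod.cong) auto
    also have "\<dots> = (\<Prod>k\<in>{k\<in>{1..n}. \<not> u dvd k}. 1 - fps_X ^ k) * Q"
      unfolding Q_def by (rule prod.union_disjoint) auto
    finally have "S u * P = (S u * (\<Prod>k\<in>{k\<in>{1..n}. \<not> u dvd k}. 1 - fps_X ^ k)) * Q"
      by (simp add: mult.assoc)
    also have "\<dots> = Q"
      unfolding S_def by (subst partition_fps_mult_prod) auto
    finally have "S u * (R * P) = R * Q" by (metis mult.left_commute)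
    then have SQ: "S u = R * Q" by (simp add: RP)
    have "E u = (\<Prod>k\<in>(*) u ` {1..n}. 1 - fps_X ^ k)"
      unfolding E_def using that by (subst prod.reindex) (auto simp: inj_on_def)
    also have "(*) u ` {1..n} = {k\<in>{1..n}. u dvd k} \<union> {k \<in> (*) u ` {1..n}. k > n}"
    proof (intro equalityI subsetI)
      fix k assume k: "k \<in> {k\<in>{1..n}. u dvd k} \<union> {k \<in> (*) u ` {1..n}. k > n}"
      show "k \<in> (*) u ` {1..n}"
      proof (cases "k \<in> (*) u ` {1..n}")
        case False
        with k obtain j where j: "k = u * j" "1 \<le> u * j" "u * j \<le> n" by (auto elim!: dvdE)
        moreover have "j \<le> u * j" using that by simp
        ultimately have "j \<in> {1..n}" by (cases j) auto
        with j show ?thesis by blast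
      qed
    qed (use that in auto)
    also have "(\<Prod>k\<in>\<dots>. 1 - fps_X ^ k) = Q * (\<Prod>k\<in>{k \<in> (*) u ` {1..n}. k > n}. 1 - fps_X ^ k)"
      unfolding Q_def by (rule prod.union_disjoint) auto
    finally have EQ: "E u = Q * (\<Prod>k\<in>{k \<in> (*) u ` {1..n}. k > n}. 1 - fps_X ^ k)" .
    have "fps_cong 3 n (\<Prod>k\<in>{k \<in> (*) u ` {1..n}. k > n}. 1 - fps_X ^ k) 1"
      by (rule fps_cong_prod_1) (auto simp: fps_cong_def fps_X_power_nth)
    then have "fps_cong 3 n (Q * (\<Prod>k\<in>{k \<in> (*) u ` {1..n}. k > n}. 1 - fps_X ^ k)) (Q * 1)"
      by (intro fps_cong_mult) auto
    then show ?thesis unfolding SQ EQ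
      by (intro fps_cong_mult) (auto intro: fps_cong_sym)
  qed
  obtain b where b: "E 3 = P ^ 3 + 3 * b"
    using prod_one_minus_power_cube[of "fps_X :: int fps" "{1..n}"] unfolding E_def P_def by blast
  have "fps_cong 3 n (S 3 * S v) ((R * E 3) * (R * E v))"
    using assms by (intro fps_cong_mult SE) auto
  also have "(R * E 3) * (R * E v) = (R * P) * (R * P) * P * E v + 3 * (R * R * b * E v)"
    unfolding b by (simp add: power3_eq_cube algebra_simps)
  also have "\<dots> = P * E v + 3 * (R * R * b * E v)" by (simp add: RP)
  finally have *: "fps_cong 3 n (S 3 * S v) (P * E v + 3 * (R * R * b * E v))" .
  have "fps_nth (3 * f) i = 3 * fps_nth f i" for f :: "int fps" and i
    by (metis fps_mult_left_const_nth fps_numeral_fps_const)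
  then have "fps_cong 3 n (P * E v + 3 * (R * R * b * E v)) (P * E v)"
    by (simp add: fps_cong_def cong_def)
  with * have "fps_cong 3 n (S 3 * S v) (P * E v)" by (rule fps_cong_trans)
  then show ?thesis
    unfolding fps_cong_def B_eq_fps_nth S_def P_def E_def by (simp add: power_mult)
qed

section \<open>The pentagonal number theorem\<close>

definition pent :: "int \<Rightarrow> nat" where
  "pent j = nat (j * (3 * j + 1) div 2)"

lemma pent_eq: "24 * int (pent j) + 1 = (6 * j + 1)\<^sup>2"
proof -
  have "0 \<le> j * (3 * j + 1)"
    by (cases "j \<ge> 0") (auto intro: mult_nonneg_nonneg mult_nonpos_nonpos)
  moreover have "even (j * (3 * j + 1))" by auto
  ultimately have "2 * int (pent j) = j * (3 * j + 1)"
    by (auto simp: pent_def)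
  then show ?thesis by (simp add: power2_eq_square algebra_simps)
qed

lemma abs_le_pent: "\<bar>j\<bar> \<le> int (pent j)"
proof -
  have "24 * \<bar>j\<bar> + 1 \<le> (6 * j + 1)\<^sup>2"
  proof (cases "j \<ge> 0")
    case True
    have "j \<le> j * j" using True by (cases "j = 0") auto
    with True show ?thesis by (simp add: power2_eq_square algebra_simps)
  next
    case False
    have "0 \<le> (- j) * (- j - 1)" using False by (intro mult_nonneg_nonneg) auto
    with False show ?thesis by (simp add: power2_eq_square algebra_simps)
  qed
  then show ?thesis unfolding pent_eq[symmetric] by simp
qed

lemma pent_Suc: "pent (int (Suc n)) = Suc n * Suc n + Suc n * (Suc n + 1) div 2"
proof -
  have "24 * int (pent (int (Suc n))) = 24 * int (Suc n * Suc n + Suc n * (Suc n + 1) div 2)"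
  proof -
    have "2 * (Suc n * (Suc n + 1) div 2) = Suc n * (Suc n + 1)" by simp
    then have "2 * int (Suc n * (Suc n + 1) div 2) = int (Suc n * (Suc n + 1))"
      by (metis of_nat_mult of_nat_numeral)
    then show ?thesis using pent_eq[of "int (Suc n)"]
      by (simp add: power2_eq_square algebra_simps)
  qed
  then show ?thesis by (simp only: mult_cancel_left of_nat_eq_iff) simp
qed

lemma pent_minus_Suc: "pent (- int (Suc n)) = n + 1 + n + n * n + n * (n + 1) div 2"
proof -
  have "2 * (n * (n + 1) div 2) = n * (n + 1)" by simp
  then have "2 * int (n * (n + 1) div 2) = int (n * (n + 1))"
    by (metis of_nat_mult of_nat_numeral)
  then have "24 * int (pent (- int (Suc n))) = 24 * int (n + 1 + n + n * n + n * (n + 1) div 2)"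
    using pent_eq[of "- int (Suc n)"]
    by (simp add: power2_eq_square algebra_simps)
  then show ?thesis by (simp only: mult_cancel_left of_nat_eq_iff) simp
qed

text \<open>
  Both sums run over the same summands up to one factor \<open>1 - x\<^sup>n\<^sup>+\<^sup>1\<close> and a shift by \<open>x\<^sup>s\<close>; their
  difference telescopes.
\<close>
lemma shanks_step:
  fixes x :: "'a :: comm_ring_1"
  assumes "m \<le> n"
  shows "(\<Sum>s\<le>m. (-1) ^ s * (\<Prod>k=Suc s..Suc n. 1 - x ^ k) * x ^ (s * Suc n + s * (s + 1) div 2)) =
         (\<Sum>s\<le>m. (-1) ^ s * (\<Prod>k=Suc s..n. 1 - x ^ k) * x ^ (s * n + s * (s + 1) div 2)) -
         (-1) ^ m * (\<Prod>k=Suc m..n. 1 - x ^ k) * x ^ (n + 1 + m + m * n + m * (m + 1) div 2)"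
  using assms
proof (induction m)
  case 0
  then show ?case by (simp add: algebra_simps)
next
  case (Suc m)
  define Q where "Q = (\<Prod>k=Suc (Suc m)..n. 1 - x ^ k)"
  define e where "e = m * (m + 1) div 2"
  have e: "Suc m * (Suc m + 1) div 2 = e + m + 1" 
    unfolding e_def by (simp add: algebra_simps)
  have Q: "(\<Prod>k=Suc m..n. 1 - x ^ k) = (1 - x ^ Suc m) * Q"
    unfolding Q_def using Suc.prems by (subst prod.atLeast_Suc_atMost) auto
  have Q': "(\<Prod>k=Suc (Suc m)..Suc n. 1 - x ^ k) = Q * (1 - x ^ Suc n)"
    unfolding Q_def using Suc.prems by (simp add: prod.cl_ivl_Suc)
  have IH: "(\<Sum>s\<le>m. (-1) ^ s * (\<Prod>k=Suc s..Suc n. 1 - x ^ k) * x ^ (s * Suc n + s * (s + 1) div 2)) =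
         (\<Sum>s\<le>m. (-1) ^ s * (\<Prod>k=Suc s..n. 1 - x ^ k) * x ^ (s * n + s * (s + 1) div 2)) -
         (-1) ^ m * ((1 - x ^ Suc m) * Q) * x ^ (n + 1 + m + m * n + e)"
    using Suc.IH Suc.prems unfolding Q e_def by linarith
  show ?case
    unfolding sum.atMost_Suc IH e Q' Q_def[symmetric]
    by (simp add: algebra_simps power_add)
qed

text \<open>
  A finite form of the pentagonal number theorem, due to Shanks: every summand with \<open>s > 0\<close> on the
  left is divisible by \<open>x\<^sup>n\<^sup>+\<^sup>1\<close>.
\<close>
lemma shanks_identity:
  fixes x :: "'a :: comm_ring_1"
  shows "(\<Sum>s\<le>n. (-1) ^ s * (\<Prod>k=Suc s..n. 1 - x ^ k) * x ^ (s * n + s * (s + 1) div 2)) =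
         (\<Sum>j=-int n..int n. (-1) ^ nat \<bar>j\<bar> * x ^ pent j)"
proof (induction n)
  case 0
  then show ?case by (simp add: pent_def)
next
  case (Suc n)
  have ivl: "{- int (Suc n)..int (Suc n)} = insert (- int (Suc n)) (insert (int (Suc n)) {-int n..int n})"
    by auto
  have "(\<Sum>s\<le>Suc n. (-1) ^ s * (\<Prod>k=Suc s..Suc n. 1 - x ^ k) * x ^ (s * Suc n + s * (s + 1) div 2)) =
    (\<Sum>j=-int n..int n. (-1) ^ nat \<bar>j\<bar> * x ^ pent j) - (-1) ^ n * x ^ pent (- int (Suc n))
     + (-1) ^ Suc n * x ^ pent (int (Suc n))"
    unfolding sum.atMost_Suc shanks_step[OF order_refl] Suc.IH pent_Suc pent_minus_Suc
    by simp
  also have "\<dots> = (\<Sum>j=-int (Suc n)..int (Suc n). (-1) ^ nat \<bar>j\<bar> * x ^ pent j)"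
    unfolding ivl by (simp del: of_nat_Suc)
  finally show ?case .
qed

lemma euler_prod_cong_pentagonal:
  assumes "v > 0"
  shows "fps_cong m n (\<Prod>k=1..n. 1 - (fps_X ^ v) ^ k)
           (\<Sum>j=-int n..int n. (-1) ^ nat \<bar>j\<bar> * (fps_X ^ v) ^ pent j)"
proof -
  define t where "t s = (-1) ^ s * (\<Prod>k=Suc s..n. 1 - ((fps_X :: int fps) ^ v) ^ k) *
     (fps_X ^ v) ^ (s * n + s * (s + 1) div 2)" for s
  have 0: "fps_nth (t s) i = 0" if "s \<in> {1..n}" "i \<le> n" for s i
  proof -
    have "n < s * n + s * (s + 1) div 2"
      using that by (cases s) (auto simp: algebra_simps intro: trans_less_add1)
    also have "\<dots> \<le> v * \<dots>" using assms by simp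
    finally have "\<not> v * (s * n + s * (s + 1) div 2) \<le> i" using that by simp
    then show ?thesis
      unfolding t_def power_mult[symmetric] by (subst fps_X_power_mult_right_nth) auto
  qed
  have "(\<Sum>s\<le>n. t s) = t 0 + (\<Sum>s=1..n. t s)"
    by (simp add: atMost_atLeast0 sum.atLeast_Suc_atMost)
  then have "fps_nth (t 0) i = fps_nth (\<Sum>s\<le>n. t s) i" if "i \<le> n" for i
    using that by (simp add: fps_sum_nth 0)
  moreover have "t 0 = (\<Prod>k=1..n. 1 - (fps_X ^ v) ^ k)" by (simp add: t_def)
  ultimately show ?thesis
    using shanks_identity[where n = n and x = "fps_X ^ v :: int fps"] unfolding fps_cong_def t_def by simp
qed

text \<open>
  Every integer coprime to 6 is \<open>\<plusminus>(6i + 1)\<close> for a unique \<open>i\<close>, so this set contains each solution of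
  \<open>x\<^sup>2 + Dy\<^sup>2 = M\<close> with \<open>xy\<close> coprime to 6 once up to the signs of \<open>x\<close> and \<open>y\<close>.
\<close>
definition reps :: "int \<Rightarrow> int \<Rightarrow> (int \<times> int) set" where
  "reps D M = {(i, j). (6 * i + 1)\<^sup>2 + D * (6 * j + 1)\<^sup>2 = M}"

lemma B_3_cong_sum_reps:
  assumes "v > 0"
  shows "[int (B 3 v n) =
    (\<Sum>(i, j)\<in>reps (int v) (24 * int n + int v + 1). if even (i + j) then 1 else -1)] (mod 3)"
proof -
  let ?I = "{-int n..int n}"
  let ?s = "\<lambda>j :: int. (-1) ^ nat \<bar>j\<bar> :: int"
  define F where "F u = (\<Sum>j\<in>?I. (-1) ^ nat \<bar>j\<bar> * ((fps_X :: int fps) ^ u) ^ pent j)" for u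
  have "fps_cong 3 n ((\<Prod>k=1..n. 1 - (fps_X ^ 1) ^ k) * (\<Prod>k=1..n. 1 - (fps_X ^ v) ^ k)) (F 1 * F v)"
    using assms unfolding F_def by (intro fps_cong_mult euler_prod_cong_pentagonal) auto
  then have *: "[int (B 3 v n) = fps_nth (F 1 * F v) n] (mod 3)"
    using B_3_cong_euler_prod[OF assms, of n] unfolding fps_cong_def
    by (auto intro: cong_trans)
  have sgn: "((-1) ^ k * fps_X ^ e :: int fps) = fps_const ((-1) ^ k) * fps_X ^ e" for k e
    by (simp add: fps_const_power[symmetric] fps_const_neg[symmetric] del: fps_const_neg fps_const_power)
  have "F 1 * F v = (\<Sum>(i,j)\<in>?I \<times> ?I. fps_const (?s i * ?s j) * fps_X ^ (pent i + v * pent j))"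
    unfolding F_def sum_product sum.cartesian_product
  proof (intro sum.cong refl, safe)
    fix i j
    have "(-1) ^ nat \<bar>i\<bar> * (fps_X ^ 1) ^ pent i * ((-1) ^ nat \<bar>j\<bar> * (fps_X ^ v) ^ pent j) =
      fps_const (?s i) * fps_X ^ pent i * (fps_const (?s j) * fps_X ^ (v * pent j))"
      by (simp only: sgn power_mult[symmetric] power_one_right)
    also have "\<dots> = fps_const (?s i * ?s j) * fps_X ^ (pent i + v * pent j)"
      by (simp only: power_add fps_const_mult[symmetric] ac_simps)
    finally show "(-1) ^ nat \<bar>i\<bar> * (fps_X ^ 1) ^ pent i * ((-1) ^ nat \<bar>j\<bar> * (fps_X ^ v) ^ pent j) =
      fps_const (?s i * ?s j) * fps_X ^ (pent i + v * pent j)" .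
  qed
  moreover have "fps_nth (fps_const c * fps_X ^ e) n = (if e = n then c else 0)" for c :: int and e
    by (simp add: fps_X_power_nth)
  ultimately have "fps_nth (F 1 * F v) n =
      (\<Sum>(i,j)\<in>?I \<times> ?I. if pent i + v * pent j = n then ?s i * ?s j else 0)"
    by (simp only: fps_sum_nth case_prod_unfold)
  also have "\<dots> = (\<Sum>(i,j)\<in>{(i,j)\<in>?I \<times> ?I. pent i + v * pent j = n}. ?s i * ?s j)"
    by (simp only: case_prod_unfold prod.collapse sum.inter_filter finite_cartesian_product
        finite_atLeastAtMost_int)
  also have "{(i,j)\<in>?I \<times> ?I. pent i + v * pent j = n} = reps (int v) (24 * int n + int v + 1)"
  proof -
    have eq: "pent i + v * pent j = n \<longleftrightarrow>
        (6 * i + 1)\<^sup>2 + int v * (6 * j + 1)\<^sup>2 = 24 * int n + int v + 1" for i j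
    proof -
      have "pent i + v * pent j = n \<longleftrightarrow> int (pent i) + int v * int (pent j) = int n"
        by (metis of_nat_add of_nat_eq_iff of_nat_mult)
      moreover have "int v * (24 * int (pent j) + 1) = 24 * (int v * int (pent j)) + int v"
        by (simp add: distrib_left)
      ultimately show ?thesis unfolding pent_eq[symmetric] by presburger
    qed
    have "i \<in> ?I \<and> j \<in> ?I" if "pent i + v * pent j = n" for i j
    proof -
      have "pent j \<le> v * pent j" using assms by simp
      then have "pent i \<le> n" "pent j \<le> n" using that by linarith+
      then show ?thesis using abs_le_pent[of i] abs_le_pent[of j] by auto
    qed
    then show ?thesis by (auto simp: reps_def eq)
  qed
  also have "(\<Sum>(i,j)\<in>reps (int v) (24 * int n + int v + 1). ?s i * ?s j) =
     (\<Sum>(i, j)\<in>reps (int v) (24 * int n + int v + 1). if even (i + j) then 1 else -1)"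
    by (intro sum.cong) (auto simp: minus_one_power_iff even_nat_iff)
  finally show ?thesis using * by simp
qed

section \<open>The quadratic form \<open>x\<^sup>2 + Dy\<^sup>2\<close>\<close>

lemma thue:
  fixes p :: nat and s :: int
  assumes "prime p"
  obtains x y :: int where "(x, y) \<noteq> (0, 0)" "x\<^sup>2 < int p" "y\<^sup>2 < int p" "int p dvd x - s * y"
proof -
  define k where "k = floor_sqrt p"
  have k: "k\<^sup>2 \<le> p" "p < (Suc k)\<^sup>2"
    by (auto simp: k_def Suc_floor_sqrt_power2_gt)
  have "k\<^sup>2 \<noteq> p" using assms by (metis prime_power_iff zero_neq_numeral one_neq_zero numeral_eq_one_iff semiring_norm(85))
  then have kp: "(int k)\<^sup>2 < int p" using k(1) by (metis le_neq_implies_less of_nat_less_iff of_nat_power)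
  define f where "f = (\<lambda>(x, y). (x - s * y) mod int p)"
  have "f ` ({0..int k} \<times> {0..int k}) \<subseteq> {0..<int p}"
    using assms by (auto simp: f_def prime_gt_0_nat)
  then have "card (f ` ({0..int k} \<times> {0..int k})) \<le> p"
    by (metis card_atLeastLessThan_int card_mono diff_zero finite_atLeastLessThan_int nat_int)
  also have "p < card ({0..int k} \<times> {0..int k})"
    using k(2) by (simp add: card_cartesian_product power2_eq_square nat_add_distrib)
  finally have "\<not> inj_on f ({0..int k} \<times> {0..int k})" by (rule pigeonhole)
  then obtain u v where uv: "u \<in> {0..int k} \<times> {0..int k}" "v \<in> {0..int k} \<times> {0..int k}" "u \<noteq> v" "f u = f v"
    unfolding inj_on_def by blast
  obtain a b a' b' where "u = (a, b)" "v = (a', b')" by (meson surj_pair)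
  with uv have ab: "a \<in> {0..int k}" "b \<in> {0..int k}" "a' \<in> {0..int k}" "b' \<in> {0..int k}"
    "(a, b) \<noteq> (a', b')" "f (a, b) = f (a', b')"
    by auto
  have sq: "u\<^sup>2 < int p" if "\<bar>u\<bar> \<le> int k" for u
    using kp that by (metis abs_ge_zero le_less_trans power2_abs power_mono)
  have "int p dvd (a - s * b) - (a' - s * b')"
    using ab(6) unfolding f_def by (simp add: mod_eq_dvd_iff)
  moreover have "(a - s * b) - (a' - s * b') = (a - a') - s * (b - b')"
    by (simp add: algebra_simps)
  ultimately show ?thesis
    using ab(1-5) by (intro that[of "a - a'" "b - b'"] sq) auto
qed

lemma residue_imp_small_multiple:
  fixes p :: nat and s D :: int
  assumes "prime p" "D > 0" "int p dvd s\<^sup>2 + D"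
  obtains x y k :: int where "1 \<le> k" "k \<le> D" "x\<^sup>2 + D * y\<^sup>2 = k * int p"
proof -
  obtain x y where xy: "(x, y) \<noteq> (0, 0)" "x\<^sup>2 < int p" "y\<^sup>2 < int p" "int p dvd x - s * y"
    using thue[OF assms(1)] .
  have "x\<^sup>2 + D * y\<^sup>2 = (x - s * y) * (x + s * y) + (s\<^sup>2 + D) * y\<^sup>2"
    by (simp add: power2_eq_square algebra_simps)
  then have "int p dvd x\<^sup>2 + D * y\<^sup>2" using xy(4) assms(3) by simp
  then obtain k where k: "x\<^sup>2 + D * y\<^sup>2 = k * int p" by (metis dvd_def mult.commute)
  have "x\<^sup>2 + D * y\<^sup>2 > 0" using xy(1) assms(2)
    by (cases "x = 0") (auto intro: add_pos_nonneg)
  then have "k > 0" unfolding k by (simp add: zero_less_mult_iff)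
  have "D * y\<^sup>2 < D * int p" using xy(3) assms(2) by simp
  then have "k * int p < (D + 1) * int p" using xy(2) k by (simp add: algebra_simps)
  then have "k < D + 1" by (simp add: mult_less_cancel_right)
  with \<open>k > 0\<close> k show ?thesis by (intro that[of k x y]) auto
qed

lemma nonresidue_dvd_form:
  fixes p x y D :: int
  assumes "prime p" "\<nexists>s. p dvd s\<^sup>2 + D" "p dvd x\<^sup>2 + D * y\<^sup>2"
  shows "p dvd x \<and> p dvd y"
proof -
  have "p dvd y"
  proof (rule ccontr)
    assume "\<not> p dvd y"
    then have "coprime y p" using assms(1) by (simp add: coprime_commute prime_imp_coprime)
    then obtain t where t: "[y * t = 1] (mod p)" using cong_solve_coprime_int by blast
    have "(x * t)\<^sup>2 + D * (y * t)\<^sup>2 = (x\<^sup>2 + D * y\<^sup>2) * t\<^sup>2"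
      by (simp add: power_mult_distrib distrib_right)
    then have "p dvd (x * t)\<^sup>2 + D * (y * t)\<^sup>2"
      using assms(3) by simp
    moreover have "[(x * t)\<^sup>2 + D * (y * t)\<^sup>2 = (x * t)\<^sup>2 + D * 1\<^sup>2] (mod p)"
      using t by (intro cong_add cong_mult cong_pow cong_refl)
    ultimately have "p dvd (x * t)\<^sup>2 + D" by (simp add: cong_dvd_iff)
    with assms(2) show False by blast
  qed
  then have "p dvd x\<^sup>2" using assms(3) by (simp add: dvd_add_left_iff power2_eq_square)
  with \<open>p dvd y\<close> show ?thesis using assms(1) prime_dvd_power by blast
qed

lemma nonresidue_no_odd_power:
  fixes p x y D m :: int
  assumes "prime p" "\<nexists>s. p dvd s\<^sup>2 + D" "\<not> p dvd m"
  shows "x\<^sup>2 + D * y\<^sup>2 \<noteq> p ^ (2 * a + 1) * m"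
proof (induction a arbitrary: x y)
  case 0
  show ?case
  proof
    assume eq: "x\<^sup>2 + D * y\<^sup>2 = p ^ (2 * 0 + 1) * m"
    then obtain u v where "x = p * u" "y = p * v"
      using nonresidue_dvd_form[OF assms(1,2), of x y] by (auto elim!: dvdE)
    with eq have "p * (p * (u\<^sup>2 + D * v\<^sup>2)) = p * m" by (simp add: power2_eq_square algebra_simps)
    then have "p * (u\<^sup>2 + D * v\<^sup>2) = m" using assms(1) by (simp only: mult_cancel_left) auto
    with assms(3) show False by auto
  qed
next
  case (Suc a)
  show ?case
  proof
    assume eq: "x\<^sup>2 + D * y\<^sup>2 = p ^ (2 * Suc a + 1) * m"
    then obtain u v where "x = p * u" "y = p * v"
      using nonresidue_dvd_form[OF assms(1,2), of x y] by (auto elim!: dvdE)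
    with eq have "p\<^sup>2 * (u\<^sup>2 + D * v\<^sup>2) = p\<^sup>2 * (p ^ (2 * a + 1) * m)"
      by (simp add: power2_eq_square algebra_simps)
    then have "u\<^sup>2 + D * v\<^sup>2 = p ^ (2 * a + 1) * m"
      using assms(1) by (simp only: mult_cancel_left) auto
    with Suc.IH show False by blast
  qed
qed

lemma form_eq_succ_mult_prime_if_dvd:
  fixes p c d D x y :: int
  assumes "prime p" "p = c\<^sup>2 + D * d\<^sup>2" "D > 0" "\<nexists>s. s\<^sup>2 = D + 1"
    and eq: "x\<^sup>2 + D * y\<^sup>2 = (D + 1) * p" and dvd: "p dvd c * y - d * x"
  shows "x\<^sup>2 = (c - D * d)\<^sup>2 \<and> y\<^sup>2 = (c + d)\<^sup>2 \<or> x\<^sup>2 = (c + D * d)\<^sup>2 \<and> y\<^sup>2 = (c - d)\<^sup>2"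
proof -
  obtain t where t: "c * y - d * x = p * t" using dvd by blast
  \<comment> \<open>Division in \<open>\<int>[\<surd>-D]\<close>: \<open>s + t\<surd>-D\<close> is the quotient of \<open>x + y\<surd>-D\<close> by \<open>c + d\<surd>-D\<close>,
    and its norm is \<open>D + 1\<close>.\<close>
  have "(c * x + D * d * y)\<^sup>2 + D * (c * y - d * x)\<^sup>2 = (c\<^sup>2 + D * d\<^sup>2) * (x\<^sup>2 + D * y\<^sup>2)"
    by (simp add: power2_eq_square algebra_simps)
  then have "(c * x + D * d * y)\<^sup>2 + D * (p * t)\<^sup>2 = p * ((D + 1) * p)"
    unfolding t eq assms(2)[symmetric] .
  then have sq: "(c * x + D * d * y)\<^sup>2 = p\<^sup>2 * (D + 1 - D * t\<^sup>2)"
    by (simp add: power2_eq_square algebra_simps)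
  then have "p dvd (c * x + D * d * y)\<^sup>2" by (simp add: power2_eq_square)
  then have "p dvd c * x + D * d * y" using assms(1) prime_dvd_power by blast
  then obtain s where s: "c * x + D * d * y = p * s" by blast
  have p0: "p \<noteq> 0" using assms(1) by auto
  have "s\<^sup>2 = D + 1 - D * t\<^sup>2" using sq p0 unfolding s power_mult_distrib by simp
  moreover from this have "t \<noteq> 0" using assms(4) by auto
  moreover have "\<bar>t\<bar> < 2"
  proof (rule ccontr)
    assume "\<not> \<bar>t\<bar> < 2"
    then have "2\<^sup>2 \<le> \<bar>t\<bar>\<^sup>2" by (intro power_mono) auto
    then have "D * 4 \<le> D * t\<^sup>2" using assms(3) by (intro mult_left_mono) auto
    moreover have "0 \<le> s\<^sup>2" by simp
    ultimately show False using \<open>s\<^sup>2 = D + 1 - D * t\<^sup>2\<close> assms(3) by linarith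
  qed
  ultimately have "t = 1 \<or> t = -1" "s\<^sup>2 = D + 1 - D * t\<^sup>2" by auto
  then have st: "t = 1 \<or> t = -1" "s = 1 \<or> s = -1" by (auto simp: power2_eq_1_iff)
  have "p * x = c * (c * x + D * d * y) - D * d * (c * y - d * x)"
    by (simp add: assms(2) power2_eq_square algebra_simps)
  also have "\<dots> = p * (c * s - D * d * t)"
    unfolding s t by (simp add: algebra_simps)
  finally have "p * x = p * (c * s - D * d * t)" .
  then have x: "x = c * s - D * d * t" using p0 by simp
  have "p * y = c * (c * y - d * x) + d * (c * x + D * d * y)"
    by (simp add: assms(2) power2_eq_square algebra_simps)
  also have "\<dots> = p * (c * t + d * s)"
    unfolding s t by (simp add: algebra_simps)
  finally have "p * y = p * (c * t + d * s)" .
  then have y: "y = c * t + d * s" using p0 by simp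
  show ?thesis
    unfolding x y using st by (auto simp: power2_eq_square algebra_simps)
qed

lemma form_eq_succ_mult_prime:
  fixes p c d D x y :: int
  assumes "prime p" "p = c\<^sup>2 + D * d\<^sup>2" "D > 0" "\<nexists>s. s\<^sup>2 = D + 1"
    and eq: "x\<^sup>2 + D * y\<^sup>2 = (D + 1) * p"
  shows "x\<^sup>2 = (c - D * d)\<^sup>2 \<and> y\<^sup>2 = (c + d)\<^sup>2 \<or> x\<^sup>2 = (c + D * d)\<^sup>2 \<and> y\<^sup>2 = (c - d)\<^sup>2"
proof -
  have "(c * y - d * x) * (c * y - (- d) * x) = p * (y\<^sup>2 - (D + 1) * d\<^sup>2)"
  proof -
    have c2: "c\<^sup>2 = p - D * d\<^sup>2" and x2: "x\<^sup>2 = (D + 1) * p - D * y\<^sup>2"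
      using assms(2) eq by simp_all
    have "(c * y - d * x) * (c * y - (- d) * x) = c\<^sup>2 * y\<^sup>2 - d\<^sup>2 * x\<^sup>2"
      by (simp add: power2_eq_square algebra_simps)
    then show ?thesis unfolding c2 x2 by (simp add: algebra_simps)
  qed
  then have "p dvd (c * y - d * x) * (c * y - (- d) * x)" by simp
  then consider "p dvd c * y - d * x" | "p dvd c * y - (- d) * x"
    using assms(1) prime_dvd_mult_iff by blast
  then show ?thesis
  proof cases
    case 1
    then show ?thesis using form_eq_succ_mult_prime_if_dvd[OF assms] by blast
  next
    case 2
    have "p = c\<^sup>2 + D * (- d)\<^sup>2" using assms(2) by simp
    from form_eq_succ_mult_prime_if_dvd[OF assms(1) this assms(3-5) 2] show ?thesis by auto
  qed
qed

lemma coprime_6_cases: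
  fixes u :: int
  assumes "odd u" "\<not> 3 dvd u"
  obtains i where "6 * i + 1 = u \<or> 6 * i + 1 = - u"
proof -
  have "\<exists>i. 6 * i + 1 = u \<or> 6 * i + 1 = - u" using assms by presburger
  with that show ?thesis by blast
qed

lemma sq_1_mod_6_inj:
  fixes i k :: int
  assumes "(6 * i + 1)\<^sup>2 = (6 * k + 1)\<^sup>2"
  shows "i = k"
proof -
  have "6 * i + 1 = 6 * k + 1 \<or> 6 * i + 1 = - (6 * k + 1)"
    using assms by (simp add: power2_eq_iff)
  then show ?thesis by presburger
qed

lemma parity_eq_of_pm_eq_mod_12:
  fixes a b c s t z w :: int
  assumes "36 * a + 6 * s + 1 = z \<or> 36 * a + 6 * s + 1 = - z"
    "36 * b + 6 * t + 1 = w \<or> 36 * b + 6 * t + 1 = - w" "z = w + 12 * c"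
  shows "even s \<longleftrightarrow> even t"
proof -
  have *: "6 * x \<noteq> -2" for x :: int by presburger
  from assms(1,2) show ?thesis
  proof (elim disjE)
    assume "36 * a + 6 * s + 1 = z" "36 * b + 6 * t + 1 = w"
    then have "s = t + 2 * (c + 3 * b - 3 * a)" using assms(3) by auto
    then show ?thesis by simp
  next
    assume "36 * a + 6 * s + 1 = - z" "36 * b + 6 * t + 1 = - w"
    then have "t = s + 2 * (c - 3 * b + 3 * a)" using assms(3) by auto
    then show ?thesis by simp
  next
    assume "36 * a + 6 * s + 1 = z" "36 * b + 6 * t + 1 = - w"
    then have "6 * (6 * a + s + 6 * b + t - 2 * c) = -2" using assms(3) by auto
    with * show ?thesis by blast
  next
    assume "36 * a + 6 * s + 1 = - z" "36 * b + 6 * t + 1 = w"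
    then have "6 * (6 * a + s + 6 * b + t + 2 * c) = -2" using assms(3) by auto
    with * show ?thesis by blast
  qed
qed

lemma sum_reps_split:
  fixes p c d D :: int
  assumes p: "prime p" "p \<noteq> D" "odd p" "\<not> 3 dvd p" and pcd: "p = c\<^sup>2 + D * d\<^sup>2"
    and D: "D > 0" "\<nexists>s. s\<^sup>2 = D + 1" and cd: "6 dvd c * d"
  shows "(\<Sum>(i, j)\<in>reps D ((D + 1) * p). if even (i + j) then 1 else -1 :: int) \<in> {2, -2}"
proof -
  have "c \<noteq> 0"
  proof
    assume "c = 0"
    then have "p = d * (D * d)" using pcd by (simp add: power2_eq_square)
    then have "is_unit d \<or> is_unit (D * d)" 
      using p(1) irreducibleD prime_elem_imp_irreducible prime_imp_prime_elem by blast
    then have "d dvd 1" using dvd_mult_right by blast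
    then have "\<bar>d\<bar> = 1" by simp
    then have "d\<^sup>2 = 1" by (metis one_power2 power2_abs)
    with \<open>c = 0\<close> pcd p(2) show False by simp
  qed
  moreover have "d \<noteq> 0"
  proof
    assume "d = 0"
    then have "p = c * c" using pcd by (simp add: power2_eq_square)
    then have "is_unit c"
      using p(1) irreducibleD prime_elem_imp_irreducible prime_imp_prime_elem by blast
    then have "p dvd 1" using \<open>p = c * c\<close> by (metis is_unit_mult_iff)
    then show False using p(1) not_prime_unit by blast
  qed
  ultimately have cd0: "c * d \<noteq> 0" by simp
  have *: "odd (c + e * D * d)" "\<not> 3 dvd c + e * D * d" "odd (c + e * d)" "\<not> 3 dvd c + e * d"
    if "e = 1 \<or> e = -1" for e
  proof -
    have 2: "even c \<or> even d" "3 dvd c \<or> 3 dvd d"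
      using cd prime_dvd_mult_iff[of "3::int" c d] dvd_trans[of 3 6 "c * d"]
        prime_dvd_mult_iff[of "2::int" c d] dvd_trans[of 2 6 "c * d"] by auto
    have o: "odd c \<or> odd D" "odd c \<or> odd d" using p(3) unfolding pcd by auto
    have t: "\<not> 3 dvd c \<or> \<not> 3 dvd D" "\<not> 3 dvd c \<or> \<not> 3 dvd d"
      using p(4) unfolding pcd by (auto simp: power2_eq_square)
    have prime3: "3 dvd D * d \<longleftrightarrow> 3 dvd D \<or> 3 dvd d"
      using prime_dvd_mult_iff[of "3::int" D d] by simp
    show "odd (c + e * D * d)" "odd (c + e * d)" using 2(1) o that by auto
    have "3 dvd e * D * d \<longleftrightarrow> 3 dvd D * d" "3 dvd e * d \<longleftrightarrow> 3 dvd d" using that by auto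
    then show "\<not> 3 dvd c + e * D * d" "\<not> 3 dvd c + e * d"
      using 2(2) t prime3 by (metis dvd_add_left_iff dvd_add_right_iff)+
  qed
  obtain i1 where i1: "6 * i1 + 1 = c - D * d \<or> 6 * i1 + 1 = - (c - D * d)"
    using coprime_6_cases[of "c - D * d"] *[of "-1"] by auto
  obtain j1 where j1: "6 * j1 + 1 = c + d \<or> 6 * j1 + 1 = - (c + d)"
    using coprime_6_cases[of "c + d"] *[of 1] by auto
  obtain i2 where i2: "6 * i2 + 1 = c + D * d \<or> 6 * i2 + 1 = - (c + D * d)"
    using coprime_6_cases[of "c + D * d"] *[of 1] by auto
  obtain j2 where j2: "6 * j2 + 1 = c - d \<or> 6 * j2 + 1 = - (c - d)"
    using coprime_6_cases[of "c - d"] *[of "-1"] by auto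
  have sq: "(6 * i1 + 1)\<^sup>2 = (c - D * d)\<^sup>2" "(6 * j1 + 1)\<^sup>2 = (c + d)\<^sup>2"
    "(6 * i2 + 1)\<^sup>2 = (c + D * d)\<^sup>2" "(6 * j2 + 1)\<^sup>2 = (c - d)\<^sup>2"
    using i1 j1 i2 j2 by (metis power2_minus)+
  have "reps D ((D + 1) * p) = {(i1, j1), (i2, j2)}"
  proof (intro equalityI subsetI)
    fix z assume "z \<in> reps D ((D + 1) * p)"
    then obtain i j where z: "z = (i, j)" "(6 * i + 1)\<^sup>2 + D * (6 * j + 1)\<^sup>2 = (D + 1) * p"
      by (auto simp: reps_def)
    have "(6 * i + 1)\<^sup>2 = (6 * i1 + 1)\<^sup>2 \<and> (6 * j + 1)\<^sup>2 = (6 * j1 + 1)\<^sup>2 \<or>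
      (6 * i + 1)\<^sup>2 = (6 * i2 + 1)\<^sup>2 \<and> (6 * j + 1)\<^sup>2 = (6 * j2 + 1)\<^sup>2"
      using form_eq_succ_mult_prime[OF p(1) pcd D z(2)] unfolding sq .
    then have "i = i1 \<and> j = j1 \<or> i = i2 \<and> j = j2"
      by (meson sq_1_mod_6_inj)
    then show "z \<in> {(i1, j1), (i2, j2)}" unfolding z(1) by blast
  next
    fix z assume "z \<in> {(i1, j1), (i2, j2)}"
    moreover have "(c - D * d)\<^sup>2 + D * (c + d)\<^sup>2 = (D + 1) * p"
      "(c + D * d)\<^sup>2 + D * (c - d)\<^sup>2 = (D + 1) * p"
      unfolding pcd by (simp_all add: power2_eq_square algebra_simps)
    ultimately show "z \<in> reps D ((D + 1) * p)"
      by (auto simp: reps_def sq)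
  qed
  moreover have "j1 \<noteq> j2"
  proof
    assume "j1 = j2"
    then have "(c + d)\<^sup>2 = (c - d)\<^sup>2" using sq by simp
    then show False using cd0 by (simp add: power2_eq_square algebra_simps)
  qed
  \<comment> \<open>The sign \<open>(-1)\<^sup>i\<^sup>+\<^sup>j\<close> is determined by \<open>(6i+1)(6j+1)\<close> modulo 12, and \<open>12 dvd 2(1 - D)cd\<close>.\<close>
  moreover have "even (i1 + j1) \<longleftrightarrow> even (i2 + j2)"
  proof -
    obtain k where k: "c * d = 6 * k" using cd by blast
    define z1 z2 where z: "z1 = (c - D * d) * (c + d)" "z2 = (c + D * d) * (c - d)"
    have "z1 - z2 = 2 * (1 - D) * (c * d)" unfolding z by (simp add: algebra_simps)
    then have z12: "z1 = z2 + 12 * ((1 - D) * k)" unfolding k by (simp add: algebra_simps)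
    have "(6 * i1 + 1) * (6 * j1 + 1) = z1 \<or> (6 * i1 + 1) * (6 * j1 + 1) = - z1"
      using i1 j1 unfolding z by (metis mult_minus_left mult_minus_right minus_minus)
    then have 1: "36 * (i1 * j1) + 6 * (i1 + j1) + 1 = z1 \<or> 36 * (i1 * j1) + 6 * (i1 + j1) + 1 = - z1"
      by (simp add: algebra_simps)
    have "(6 * i2 + 1) * (6 * j2 + 1) = z2 \<or> (6 * i2 + 1) * (6 * j2 + 1) = - z2"
      using i2 j2 unfolding z by (metis mult_minus_left mult_minus_right minus_minus)
    then have 2: "36 * (i2 * j2) + 6 * (i2 + j2) + 1 = z2 \<or> 36 * (i2 * j2) + 6 * (i2 + j2) + 1 = - z2"
      by (simp add: algebra_simps)
    show ?thesis using 1 2 z12 by (rule parity_eq_of_pm_eq_mod_12)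
  qed
  ultimately show ?thesis by simp
qed

section \<open>The cases \<open>D = 7, 5, 2\<close>\<close>

lemma form_mod:
  fixes x y D m :: int
  shows "(x\<^sup>2 + D * y\<^sup>2) mod m = (x\<^sup>2 mod m + D * (y\<^sup>2 mod m)) mod m"
  by (rule mod_add_cong) (simp_all add: mod_mult_right_eq)

lemma sq_mod_8:
  fixes x :: int
  shows "x\<^sup>2 mod 8 \<in> {0, 1, 4}" "x\<^sup>2 mod 8 \<noteq> 1 \<Longrightarrow> even x"
proof -
  have "x mod 8 \<in> {0, 1, 2, 3, 4, 5, 6, 7}" by auto
  moreover have "x\<^sup>2 mod 8 = (x mod 8)\<^sup>2 mod 8" by (simp add: power_mod)
  moreover have "even x \<longleftrightarrow> even (x mod 8)" by (simp add: dvd_mod_iff)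
  ultimately show "x\<^sup>2 mod 8 \<in> {0, 1, 4}" "x\<^sup>2 mod 8 \<noteq> 1 \<Longrightarrow> even x" by auto
qed

lemma sq_mod_3:
  fixes x :: int
  shows "x\<^sup>2 mod 3 = 1 \<or> 3 dvd x \<and> x\<^sup>2 mod 3 = 0"
proof -
  have "x mod 3 \<in> {0, 1, 2}" by auto
  moreover have "x\<^sup>2 mod 3 = (x mod 3)\<^sup>2 mod 3" by (simp add: power_mod)
  ultimately show ?thesis by auto
qed

lemma odd_mod_8:
  fixes p :: int
  assumes "odd p"
  shows "p mod 8 \<in> {1, 3, 5, 7}"
proof -
  have "p mod 8 \<in> {0, 1, 2, 3, 4, 5, 6, 7}" by auto
  moreover have "even p \<longleftrightarrow> even (p mod 8)" by (simp add: dvd_mod_iff)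
  ultimately show ?thesis using assms by auto
qed

lemma cong_1_imp_int_mod:
  assumes "[p = 1] (mod m)" "m > 1"
  shows "int p mod int m = 1"
  using assms by (metis cong_def mod_less of_nat_1 zmod_int)

lemma residues_7_mod_8:
  fixes X Y P k :: int
  assumes "(X + 7 * Y) mod 8 = (k * P) mod 8" "k \<in> {2, 4, 6}" "P \<in> {1, 3, 5, 7}"
    "X \<in> {0, 1, 4}" "Y \<in> {0, 1, 4}"
  shows "k = 4 \<and> X \<noteq> 1 \<and> Y \<noteq> 1"
  using assms by auto

lemma residues_5_mod_8:
  fixes X Y P k :: int
  assumes "(X + 5 * Y) mod 8 = (k * P) mod 8" "k \<in> {2, 3, 4}" "P \<in> {1, 5}"
    "X \<in> {0, 1, 4}" "Y \<in> {0, 1, 4}"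
  shows "k = 4 \<and> X \<noteq> 1 \<and> Y \<noteq> 1"
  using assms by auto

lemma nonresidue_not_multiple:
  fixes x y q p D :: int
  assumes "prime q" "\<nexists>s. q dvd s\<^sup>2 + D" "\<not> q dvd p"
  shows "x\<^sup>2 + D * y\<^sup>2 \<noteq> q * p"
  using nonresidue_no_odd_power[OF assms, of x y 0] by simp

lemma prime_eq_form_7:
  fixes p :: nat and s :: int
  assumes p: "prime p" "int p mod 6 = 1" and s: "int p dvd s\<^sup>2 + 7"
  obtains c d :: int where "int p = c\<^sup>2 + 7 * d\<^sup>2"
proof -
  obtain x y k where k: "1 \<le> k" "k \<le> 7" and xy: "x\<^sup>2 + 7 * y\<^sup>2 = k * int p"
    using residue_imp_small_multiple[OF p(1) zero_less_numeral s] by blast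
  have 3: "\<nexists>s::int. 3 dvd s\<^sup>2 + 7"
  proof
    assume "\<exists>s::int. 3 dvd s\<^sup>2 + 7"
    then obtain s :: int where s: "3 dvd s\<^sup>2 + 7" by blast
    then have "(s\<^sup>2 mod 3 + 7 mod 3) mod 3 = 0" by (simp only: mod_add_eq dvd_eq_mod_eq_0)
    with sq_mod_3[of s] show False by auto
  qed
  have 5: "\<nexists>s::int. 5 dvd s\<^sup>2 + 7"
  proof
    assume "\<exists>s::int. 5 dvd s\<^sup>2 + 7"
    then obtain s :: int where "5 dvd s\<^sup>2 + 7" by blast
    then have "(s\<^sup>2 + 7) mod 5 = 0" by simp
    then have "((s mod 5)\<^sup>2 + 7) mod 5 = 0" by (metis mod_add_left_eq power_mod)
    moreover have "s mod 5 \<in> {0, 1, 2, 3, 4}" by auto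
    ultimately show False by auto
  qed
  have "\<not> 3 dvd int p" using p(2) by presburger
  then have "k \<noteq> 3" using nonresidue_not_multiple[OF _ 3] xy by auto
  have "\<not> 5 dvd int p"
  proof
    assume "5 dvd int p"
    then have "5 dvd p" by presburger
    then have "p = 5" using p(1) primes_dvd_imp_eq[of 5 p] by simp
    with p(2) show False by simp
  qed
  then have "k \<noteq> 5" using nonresidue_not_multiple[OF _ 5] xy by auto
  have mod8: "(x\<^sup>2 mod 8 + 7 * (y\<^sup>2 mod 8)) mod 8 = (k * (int p mod 8)) mod 8"
    using xy form_mod[of x 7 y 8] by (simp add: mod_mult_right_eq)
  have "odd (int p)" using p(2) by presburger
  note p8 = odd_mod_8[OF this]
  have res: "k = 4 \<and> x\<^sup>2 mod 8 \<noteq> 1 \<and> y\<^sup>2 mod 8 \<noteq> 1" if "k \<in> {2, 4, 6}"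
    using residues_7_mod_8[OF mod8 that p8 sq_mod_8(1) sq_mod_8(1)] .
  have "k \<in> {1, 2, 4, 6, 7}" using k \<open>k \<noteq> 3\<close> \<open>k \<noteq> 5\<close> by auto
  then consider "k = 1" | "k = 4" | "k = 7" using res by blast
  then show ?thesis
  proof cases
    case 1
    with xy show ?thesis by (intro that[of x y]) simp
  next
    case 2
    then have "even x" "even y" using res sq_mod_8(2) by blast+
    then obtain a b where "x = 2 * a" "y = 2 * b" by (meson evenE)
    with 2 xy show ?thesis by (intro that[of a b]) (simp add: power_mult_distrib)
  next
    case 3
    have "x\<^sup>2 = 7 * (int p - y\<^sup>2)" using xy 3 by simp
    then have "7 dvd x\<^sup>2" by simp
    then have "7 dvd x" using prime_dvd_power[of "7::int" x 2] by simp
    then obtain a where "x = 7 * a" by blast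
    with xy 3 have "7 * (y\<^sup>2 + 7 * a\<^sup>2) = 7 * int p" by (simp add: power2_eq_square)
    then show ?thesis by (intro that[of y a]) simp
  qed
qed

lemma prime_eq_form_5:
  fixes p :: nat and s :: int
  assumes p: "prime p" "int p mod 4 = 1" and s: "int p dvd s\<^sup>2 + 5"
  obtains c d :: int where "int p = c\<^sup>2 + 5 * d\<^sup>2"
proof -
  obtain x y k where k: "1 \<le> k" "k \<le> 5" and xy: "x\<^sup>2 + 5 * y\<^sup>2 = k * int p"
    using residue_imp_small_multiple[OF p(1) zero_less_numeral s] by blast
  have mod8: "(x\<^sup>2 mod 8 + 5 * (y\<^sup>2 mod 8)) mod 8 = (k * (int p mod 8)) mod 8"
    using xy form_mod[of x 5 y 8] by (simp add: mod_mult_right_eq)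
  have "odd (int p)" using p(2) by presburger
  moreover have "int p mod 8 mod 4 = 1" using p(2) by (simp add: mod_mod_cancel)
  ultimately have p8: "int p mod 8 \<in> {1, 5}"
    using odd_mod_8[of "int p"] by auto
  have res: "k = 4 \<and> x\<^sup>2 mod 8 \<noteq> 1 \<and> y\<^sup>2 mod 8 \<noteq> 1" if "k \<in> {2, 3, 4}"
    using residues_5_mod_8[OF mod8 that p8 sq_mod_8(1) sq_mod_8(1)] .
  have "k \<in> {1, 2, 3, 4, 5}" using k by auto
  then consider "k = 1" | "k = 4" | "k = 5" using res by blast
  then show ?thesis
  proof cases
    case 1
    with xy show ?thesis by (intro that[of x y]) simp
  next
    case 2
    then have "even x" "even y" using res sq_mod_8(2) by blast+
    then obtain a b where "x = 2 * a" "y = 2 * b" by (meson evenE)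
    with 2 xy show ?thesis by (intro that[of a b]) (simp add: power_mult_distrib)
  next
    case 3
    have "x\<^sup>2 = 5 * (int p - y\<^sup>2)" using xy 3 by simp
    then have "5 dvd x\<^sup>2" by simp
    then have "5 dvd x" using prime_dvd_power[of "5::int" x 2] by simp
    then obtain a where "x = 5 * a" by blast
    with xy 3 have "5 * (y\<^sup>2 + 5 * a\<^sup>2) = 5 * int p" by (simp add: power2_eq_square)
    then show ?thesis by (intro that[of y a]) simp
  qed
qed

lemma prime_eq_form_2:
  fixes p :: nat and s :: int
  assumes p: "prime p" and s: "int p dvd s\<^sup>2 + 2"
  obtains c d :: int where "int p = c\<^sup>2 + 2 * d\<^sup>2"
proof -
  obtain x y k where k: "1 \<le> k" "k \<le> 2" and xy: "x\<^sup>2 + 2 * y\<^sup>2 = k * int p"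
    using residue_imp_small_multiple[OF p zero_less_numeral s] by blast
  then consider "k = 1" | "k = 2" by linarith
  then show ?thesis
  proof cases
    case 1
    with xy show ?thesis by (intro that[of x y]) simp
  next
    case 2
    have "x\<^sup>2 = 2 * (int p - y\<^sup>2)" using xy 2 by simp
    then have "even (x\<^sup>2)" by simp
    then obtain a where "x = 2 * a" by (auto elim!: evenE)
    with xy 2 have "2 * (y\<^sup>2 + 2 * a\<^sup>2) = 2 * int p" by (simp add: power2_eq_square)
    then show ?thesis by (intro that[of y a]) simp
  qed
qed

lemma sum_reps_not_cong_0:
  fixes c d D :: int and p :: nat
  assumes p: "prime p" "int p \<noteq> D" "odd p" "\<not> 3 dvd p" and pcd: "int p = c\<^sup>2 + D * d\<^sup>2"
    and D: "D > 0" "\<nexists>s. s\<^sup>2 = D + 1" and cd: "even c \<or> even d" "3 dvd c \<or> 3 dvd d"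
  shows "\<not> [(\<Sum>(i, j)\<in>reps D ((D + 1) * int p). if even (i + j) then 1 else -1 :: int) = 0] (mod 3)"
proof -
  have "6 dvd m" if "2 dvd m" "3 dvd m" for m :: int using that by presburger
  then have "6 dvd c * d" using cd by auto
  moreover have "prime (int p)" "odd (int p)" "\<not> 3 dvd int p" using p by (simp, presburger+)
  ultimately have "(\<Sum>(i, j)\<in>reps D ((D + 1) * int p). if even (i + j) then 1 else -1 :: int) \<in> {2, -2}"
    using sum_reps_split[OF _ p(2) _ _ pcd D] by blast
  then show ?thesis by (auto simp: cong_def)
qed

lemma reps_7_ramified: "reps 7 56 = {(1, 0)}"
proof (intro equalityI subsetI)
  fix z assume "z \<in> reps 7 56"
  then obtain i j where z: "z = (i, j)" "(6 * i + 1)\<^sup>2 + 7 * (6 * j + 1)\<^sup>2 = 56"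
    by (auto simp: reps_def)
  have "j = 0"
  proof (rule ccontr)
    assume "j \<noteq> 0"
    then have "3 \<le> \<bar>6 * j + 1\<bar>" by presburger
    then have "3\<^sup>2 \<le> \<bar>6 * j + 1\<bar>\<^sup>2" by (intro power_mono) auto
    then have "9 \<le> (6 * j + 1)\<^sup>2" by simp
    moreover have "0 \<le> (6 * i + 1)\<^sup>2" by simp
    ultimately show False using z(2) by linarith
  qed
  moreover from this z(2) have "(6 * i + 1)\<^sup>2 = (6 * 1 + 1)\<^sup>2" by simp
  then have "i = 1" by (rule sq_1_mod_6_inj)
  ultimately show "z \<in> {(1, 0)}" using z(1) by simp
qed (auto simp: reps_def)

lemma reps_5_ramified: "reps 5 30 = {(-1, 0)}"
proof (intro equalityI subsetI)
  fix z assume "z \<in> reps 5 30"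
  then obtain i j where z: "z = (i, j)" "(6 * i + 1)\<^sup>2 + 5 * (6 * j + 1)\<^sup>2 = 30"
    by (auto simp: reps_def)
  have "j = 0"
  proof (rule ccontr)
    assume "j \<noteq> 0"
    then have "3 \<le> \<bar>6 * j + 1\<bar>" by presburger
    then have "3\<^sup>2 \<le> \<bar>6 * j + 1\<bar>\<^sup>2" by (intro power_mono) auto
    then have "9 \<le> (6 * j + 1)\<^sup>2" by simp
    moreover have "0 \<le> (6 * i + 1)\<^sup>2" by simp
    ultimately show False using z(2) by linarith
  qed
  moreover from this z(2) have "(6 * i + 1)\<^sup>2 = (6 * (-1) + 1)\<^sup>2" by simp
  then have "i = -1" by (rule sq_1_mod_6_inj)
  ultimately show "z \<in> {(-1, 0)}" using z(1) by simp
qed (auto simp: reps_def)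

lemma sum_reps_7_not_cong_0:
  fixes p :: nat
  assumes p: "prime p" "[p = 1] (mod 6)" and s: "int p dvd s\<^sup>2 + 7"
  shows "\<not> [(\<Sum>(i, j)\<in>reps 7 ((7 + 1) * int p). if even (i + j) then 1 else -1 :: int) = 0] (mod 3)"
proof (cases "p = 7")
  case True
  then show ?thesis by (simp add: reps_7_ramified cong_def)
next
  case False
  have p6: "int p mod 6 = 1" using cong_1_imp_int_mod[OF p(2)] by simp
  obtain c d where cd: "int p = c\<^sup>2 + 7 * d\<^sup>2" using prime_eq_form_7[OF p(1) p6 s] .
  have "int p mod 3 = 1" using mod_mod_cancel[of 3 6 "int p"] p6 by simp
  then have "(c\<^sup>2 mod 3 + 7 * (d\<^sup>2 mod 3)) mod 3 = 1"
    using cd p6 form_mod[of c 7 d 3] by simp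
  then have "3 dvd c \<or> 3 dvd d" using sq_mod_3[of c] sq_mod_3[of d] by auto
  moreover have "odd (int p)" using p6 by presburger
  then have "even c \<or> even d" unfolding cd by auto
  moreover have "\<nexists>s::int. s\<^sup>2 = 7 + 1"
  proof
    assume "\<exists>s::int. s\<^sup>2 = 7 + 1"
    then obtain s :: int where "s\<^sup>2 = 8" by auto
    with sq_mod_3[of s] show False by simp
  qed
  moreover have "odd p" "\<not> 3 dvd p" using p6 by presburger+
  ultimately show ?thesis
    using sum_reps_not_cong_0[OF p(1) _ _ _ cd] False by simp
qed

lemma sum_reps_5_not_cong_0:
  fixes p :: nat
  assumes p: "prime p" "[p = 1] (mod 4)" and s: "int p dvd s\<^sup>2 + 5"
  shows "\<not> [(\<Sum>(i, j)\<in>reps 5 ((5 + 1) * int p). if even (i + j) then 1 else -1 :: int) = 0] (mod 3)"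
proof (cases "p = 5")
  case True
  then show ?thesis by (simp add: reps_5_ramified cong_def)
next
  case False
  have p4: "int p mod 4 = 1" using cong_1_imp_int_mod[OF p(2)] by simp
  have p3: "\<not> 3 dvd p"
  proof
    assume "3 dvd p"
    then have "p = 3" using p(1) primes_dvd_imp_eq[of 3 p] by simp
    with p4 show False by simp
  qed
  obtain c d where cd: "int p = c\<^sup>2 + 5 * d\<^sup>2" using prime_eq_form_5[OF p(1) p4 s] .
  have "int p mod 3 \<noteq> 0" using p3 by presburger
  then have "(c\<^sup>2 mod 3 + 5 * (d\<^sup>2 mod 3)) mod 3 \<noteq> 0"
    using cd form_mod[of c 5 d 3] by simp
  then have "3 dvd c \<or> 3 dvd d" using sq_mod_3[of c] sq_mod_3[of d] by auto
  moreover have "odd (int p)" using p4 by presburger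
  then have "even c \<or> even d" unfolding cd by auto
  moreover have "\<nexists>s::int. s\<^sup>2 = 5 + 1"
  proof
    assume "\<exists>s::int. s\<^sup>2 = 5 + 1"
    then obtain s :: int where "s\<^sup>2 = 6" by auto
    with sq_mod_8(1)[of s] show False by simp
  qed
  moreover have "odd p" using p4 by presburger
  ultimately show ?thesis
    using sum_reps_not_cong_0[OF p(1) _ _ p3 cd] False by simp
qed

lemma sum_reps_2_not_cong_0:
  fixes p :: nat
  assumes p: "prime p" "[p = 1] (mod 8)" and s: "int p dvd s\<^sup>2 + 2"
  shows "\<not> [(\<Sum>(i, j)\<in>reps 2 ((2 + 1) * int p). if even (i + j) then 1 else -1 :: int) = 0] (mod 3)"
proof -
  have p8: "int p mod 8 = 1" using cong_1_imp_int_mod[OF p(2)] by simp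
  have p3: "\<not> 3 dvd p"
  proof
    assume "3 dvd p"
    then have "p = 3" using p(1) primes_dvd_imp_eq[of 3 p] by simp
    with p8 show False by simp
  qed
  obtain c d where cd: "int p = c\<^sup>2 + 2 * d\<^sup>2" using prime_eq_form_2[OF p(1) s] .
  have "int p mod 3 \<noteq> 0" using p3 by presburger
  then have "(c\<^sup>2 mod 3 + 2 * (d\<^sup>2 mod 3)) mod 3 \<noteq> 0"
    using cd form_mod[of c 2 d 3] by simp
  then have "3 dvd c \<or> 3 dvd d" using sq_mod_3[of c] sq_mod_3[of d] by auto
  moreover have "(c\<^sup>2 mod 8 + 2 * (d\<^sup>2 mod 8)) mod 8 = 1"
    using cd p8 form_mod[of c 2 d 8] by simp
  then have "d\<^sup>2 mod 8 \<noteq> 1" using sq_mod_8(1)[of c] by auto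
  then have "even d" by (rule sq_mod_8(2))
  moreover have "\<nexists>s::int. s\<^sup>2 = 2 + 1"
  proof
    assume "\<exists>s::int. s\<^sup>2 = 2 + 1"
    then obtain s :: int where "s\<^sup>2 = 3" by auto
    with sq_mod_8(1)[of s] show False by simp
  qed
  moreover have "odd p" "p \<noteq> 2" using p8 by presburger+
  ultimately show ?thesis
    using sum_reps_not_cong_0[OF p(1) _ _ p3 cd] by simp
qed

lemma B_3_odd_prime_power_cong_0:
  fixes p t D n a :: nat
  assumes p: "prime p" "[p = 1] (mod t)" "\<not> p dvd t * n + 1" "\<not> p dvd D + 1"
    and tD: "t * (D + 1) = 24" "D > 0"
    and B: "[B 3 D ((p - 1) div t) = 0] (mod 3)"
    and split: "\<And>s. int p dvd s\<^sup>2 + int D \<Longrightarrow>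
       \<not> [(\<Sum>(i, j)\<in>reps (int D) ((int D + 1) * int p). if even (i + j) then 1 else -1 :: int) = 0] (mod 3)"
  shows "[B 3 D (p ^ (2 * a + 1) * n + (p ^ (2 * a + 1) - 1) div t) = 0] (mod 3)"
proof -
  have t_div: "t * ((q - 1) div t) + 1 = q" if "[q = 1] (mod t)" "q > 0" for q
  proof -
    have "t dvd q - 1" using that(1) by (rule cong_to_1_nat)
    then show ?thesis using that(2) by simp
  qed
  have tD': "24 * int m + int D + 1 = (int D + 1) * int (t * m + 1)" for m
  proof -
    have "int t * (int D + 1) = 24" using tD(1) by (metis of_nat_1 of_nat_add of_nat_mult of_nat_numeral)
    then have "24 * int m = (int D + 1) * (int t * int m)"
      by (metis mult.assoc mult.commute)
    then show ?thesis by (simp add: distrib_left)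
  qed
  let ?q = "p ^ (2 * a + 1)"
  define N where "N = ?q * n + (?q - 1) div t"
  have "[?q = 1 ^ (2 * a + 1)] (mod t)" using p(2) by (rule cong_pow)
  then have "t * ((?q - 1) div t) + 1 = ?q"
    using p(1) by (intro t_div) (auto simp: prime_gt_0_nat)
  then have N: "t * N + 1 = ?q * (t * n + 1)"
    unfolding N_def by (simp add: distrib_left mult.left_commute)
  have "[int (B 3 D ((p - 1) div t)) = 0] (mod 3)"
    using B by (metis cong_int_iff of_nat_0 of_nat_numeral)
  then have "[(\<Sum>(i, j)\<in>reps (int D) (24 * int ((p - 1) div t) + int D + 1). if even (i + j) then 1 else -1 :: int) = 0] (mod 3)"
    using B_3_cong_sum_reps[OF tD(2)] cong_trans cong_sym by blast
  then have "\<nexists>s. int p dvd s\<^sup>2 + int D"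
    using split unfolding tD' t_div[OF p(2) prime_gt_0_nat[OF p(1)]] by blast
  moreover have "\<not> p dvd (D + 1) * (t * n + 1)"
    using p(1,3,4) prime_dvd_mult_iff by blast
  then have "\<not> int p dvd int ((D + 1) * (t * n + 1))" by (simp only: of_nat_dvd_iff) simp
  ultimately have "x\<^sup>2 + int D * y\<^sup>2 \<noteq> int p ^ (2 * a + 1) * int ((D + 1) * (t * n + 1))" for x y
    using p(1) by (intro nonresidue_no_odd_power) auto
  moreover have "int p ^ (2 * a + 1) * int ((D + 1) * (t * n + 1)) = 24 * int N + int D + 1"
    unfolding tD' N by (simp add: algebra_simps)
  ultimately have "reps (int D) (24 * int N + int D + 1) = {}"
    by (simp add: reps_def)
  then have "[int (B 3 D N) = 0] (mod 3)"
    using B_3_cong_sum_reps[OF tD(2), of N] by simp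
  then show ?thesis
    unfolding N_def by (metis cong_int_iff of_nat_0 of_nat_numeral)
qed

lemma prime_not_dvd_pow_mult:
  fixes p :: nat
  assumes "prime p" "p \<noteq> 2" "p \<noteq> 3"
  shows "\<not> p dvd 2 ^ k * 3 ^ l"
proof
  assume "p dvd 2 ^ k * 3 ^ l"
  then have "p dvd 2 \<or> p dvd 3" using assms(1) by (meson prime_dvd_mult_iff prime_dvd_power)
  moreover have "prime (2 :: nat)" "prime (3 :: nat)" by simp_all
  ultimately show False using assms by (meson primes_dvd_imp_eq)
qed

theorem theorem1p5:
  fixes \<alpha> n :: nat
  shows
    "(\<forall>p::nat. prime p \<longrightarrow> [p = 1] (mod 6) \<longrightarrow> \<not> p dvd 3 * n + 1 \<longrightarrow>
        [B 3 7 ((p - 1) div 3) = 0] (mod 3) \<longrightarrow>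
        [B 3 7 (p ^ (2 * \<alpha> + 1) * n + (p ^ (2 * \<alpha> + 1) - 1) div 3) = 0] (mod 3)) \<and>
     (\<forall>p::nat. prime p \<longrightarrow> [p = 1] (mod 4) \<longrightarrow> \<not> p dvd 4 * n + 1 \<longrightarrow>
        [B 3 5 ((p - 1) div 4) = 0] (mod 3) \<longrightarrow>
        [B 3 5 (p ^ (2 * \<alpha> + 1) * n + (p ^ (2 * \<alpha> + 1) - 1) div 4) = 0] (mod 3)) \<and>
     (\<forall>p::nat. prime p \<longrightarrow> [p = 1] (mod 8) \<longrightarrow> \<not> p dvd 8 * n + 1 \<longrightarrow>
        [B 3 2 ((p - 1) div 8) = 0] (mod 3) \<longrightarrow>
        [B 3 2 (p ^ (2 * \<alpha> + 1) * n + (p ^ (2 * \<alpha> + 1) - 1) div 8) = 0] (mod 3))"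
proof (intro conjI allI impI)
  fix p :: nat
  assume p: "prime p" "[p = 1] (mod 6)" "\<not> p dvd 3 * n + 1" "[B 3 7 ((p - 1) div 3) = 0] (mod 3)"
  have "[p = 1] (mod 3)" using p(2) by (rule cong_dvd_modulus_nat) simp
  moreover have "p \<noteq> 2" "p \<noteq> 3" using p(2) by (auto simp: cong_def)
  moreover from this have "\<not> p dvd 7 + 1"
    using prime_not_dvd_pow_mult[OF p(1), of 3 0] by simp
  ultimately show "[B 3 7 (p ^ (2 * \<alpha> + 1) * n + (p ^ (2 * \<alpha> + 1) - 1) div 3) = 0] (mod 3)"
    using p sum_reps_7_not_cong_0[OF p(1,2)] by (intro B_3_odd_prime_power_cong_0) simp_all
next
  fix p :: nat
  assume p: "prime p" "[p = 1] (mod 4)" "\<not> p dvd 4 * n + 1" "[B 3 5 ((p - 1) div 4) = 0] (mod 3)"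
  have "p \<noteq> 2" "p \<noteq> 3" using p(2) by (auto simp: cong_def)
  then have "\<not> p dvd 5 + 1"
    using prime_not_dvd_pow_mult[OF p(1), of 1 1] by simp
  then show "[B 3 5 (p ^ (2 * \<alpha> + 1) * n + (p ^ (2 * \<alpha> + 1) - 1) div 4) = 0] (mod 3)"
    using p sum_reps_5_not_cong_0[OF p(1,2)] by (intro B_3_odd_prime_power_cong_0) simp_all
next
  fix p :: nat
  assume p: "prime p" "[p = 1] (mod 8)" "\<not> p dvd 8 * n + 1" "[B 3 2 ((p - 1) div 8) = 0] (mod 3)"
  have "p \<noteq> 2" "p \<noteq> 3" using p(2) by (auto simp: cong_def)
  then have "\<not> p dvd 2 + 1"
    using prime_not_dvd_pow_mult[OF p(1), of 0 1] by simp
  then show "[B 3 2 (p ^ (2 * \<alpha> + 1) * n + (p ^ (2 * \<alpha> + 1) - 1) div 8) = 0] (mod 3)"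
    using p sum_reps_2_not_cong_0[OF p(1,2)] by (intro B_3_odd_prime_power_cong_0) simp_all
qed

end
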